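(* Let $K$ be a pathwise connected poset and let $\mathcal{B}=(B,\pi,J,K)$ be a net bundle over $K$. For $b\in\tilde\Sigma_1(K)$ put $$Z(b):=J_{(|b|,\partial_0b)}^{-1}\,J_{(|b|,\partial_1b)}:\ \pi^{-1}(\partial_1b)\to\pi^{-1}(\partial_0b).$$ Then $Z$ is the unique flat connection of $\mathcal{B}$.
   Context: Simplices of a poset $K$: $\tilde\Sigma_n(K)$ is the set of order-preserving maps from the poset of non-empty subsets of $\{0,\dots,n\}$ (ordered by inclusion) to $K$. So $\tilde\Sigma_0(K)=K$; a $1$-simplex $b=(|b|;\partial_0b,\partial_1b)$ consists of elements of $K$ with $\partial_0b,\partial_1b\le|b|$ ($|b|$ is the support); a $2$-simplex $c$ consists of a support $|c|\in K$ and $1$-simplices $\partial_0c,\partial_1c,\partial_2c$ with $|\partial_ic|\le|c|$, $\partial_0\partial_0c=\partial_0\partial_1c$, $\partial_1\partial_0c=\partial_0\partial_2c$, $\partial_1\partial_1c=\partial_1\partial_2c$. The reverse of $b$ is $\overline b=(|b|;\partial_1b,\partial_0b)$, and $\sigma_0a=(a;a,a)$. The nerve $\Sigma_*(K)$ is a subsimplicial set: $\Sigma_1(K)$ consists of pairs $(a,\tilde a)$ with $\tilde a\le a$, with $0$-face $a$ and $1$-face $\tilde a$, identified with $(a;a,\tilde a)$; $\Sigma_2(K)$ consists of the $c$ given by chains $v_0\le v_1\le v_2$, with $\partial_0c=(v_2,v_1)$, $\partial_1c=(v_2,v_0)$, $\partial_2c=(v_1,v_0)$, $|c|=v_2$.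 $K$ is pathwise connected if any two elements are joined by a path $b_n*\cdots*b_1$ of $1$-simplices of $\tilde\Sigma_1(K)$, $\partial_0b_i=\partial_1b_{i+1}$. Net bundle over $K$: a set $B$, a surjection $\pi:B\to K$ and bijections $J_b:\pi^{-1}(\partial_1b)\to\pi^{-1}(\partial_0b)$, $b\in\Sigma_1(K)$ (the net structure), with $J_{\partial_0c}J_{\partial_2c}=J_{\partial_1c}$ for $c\in\Sigma_2(K)$ and $J_{\sigma_0a}=\mathrm{id}$ for $a\in K$. Connection on $\mathcal{B}$: a family of bijections $U(b):\pi^{-1}(\partial_1b)\to\pi^{-1}(\partial_0b)$, $b\in\tilde\Sigma_1(K)$, such that $U(\overline b)=U(b)^{-1}$ for all $b\in\tilde\Sigma_1(K)$ and $U(b)=J_b$ for all $b\in\Sigma_1(K)$. It is flat if $U(\partial_0c)U(\partial_2c)=U(\partial_1c)$ for all $c\in\tilde\Sigma_2(K)$. *)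

theory Defs
  imports "HOL-Library.FuncSet"
begin

text \<open>
  A poset is a carrier K with a relation r such that \<^term>\<open>partial_order_on K r\<close>;
  \<^term>\<open>(a, b) \<in> r\<close> is read as a \<le> b. In what follows, K and r always play these roles.
\<close>

definition cells :: "nat \<Rightarrow> nat set set"
  where "cells n = {A. A \<noteq> {} \<and> A \<subseteq> {0..n}}"

type_synonym 'k simplex = "nat set \<Rightarrow> 'k"

text \<open>Simplices are extensional on \<^term>\<open>cells n\<close>, so HOL equality is equality of simplices.\<close>

definition simplices :: "nat \<Rightarrow> 'k set \<Rightarrow> 'k rel \<Rightarrow> 'k simplex set"
  where "simplices n K r =
    {s \<in> cells n \<rightarrow>\<^sub>E K. monotone_on (cells n) (\<subseteq>) (\<lambda>x y. (x, y) \<in> r) s}"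

text \<open>The order embedding of {0..n-1} into {0..n} that omits i.\<close>

definition coface :: "nat \<Rightarrow> nat \<Rightarrow> nat"
  where "coface i j = (if j < i then j else Suc j)"

text \<open>The i-th face of an n-simplex (n > 0).\<close>

definition face :: "nat \<Rightarrow> nat \<Rightarrow> 'k simplex \<Rightarrow> 'k simplex"
  where "face n i s = restrict (\<lambda>A. s (coface i ` A)) (cells (n - 1))"

definition supp :: "nat \<Rightarrow> 'k simplex \<Rightarrow> 'k"
  where "supp n s = s {0..n}"

text \<open>
  The 0-faces of a 1-simplex, as elements of K: a 0-simplex s is identified with
  its only value \<^term>\<open>s {0}\<close>.
\<close>

definition bd0 :: "'k simplex \<Rightarrow> 'k"
  where "bd0 b = face 1 0 b {0}"

definition bd1 :: "'k simplex \<Rightarrow> 'k"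
  where "bd1 b = face 1 1 b {0}"

text \<open>\<^term>\<open>edge a u v\<close> is the 1-simplex (a; u, v): support a, 0-face u, 1-face v.\<close>

definition edge :: "'k \<Rightarrow> 'k \<Rightarrow> 'k \<Rightarrow> 'k simplex"
  where "edge a u v =
    restrict (\<lambda>A. if A = {0, 1} then a else if A = {1} then u else v) (cells 1)"

definition reverse :: "'k simplex \<Rightarrow> 'k simplex"
  where "reverse b = edge (supp 1 b) (bd1 b) (bd0 b)"

definition degen0 :: "'k \<Rightarrow> 'k simplex"
  where "degen0 a = edge a a a"

text \<open>
  The n-simplices of the nerve: a chain v 0 \<le> ... \<le> v n is the simplex
  sending A to v (Max A), so its support and the support of each face is the largest vertex.
\<close>

definition nerve :: "nat \<Rightarrow> 'k set \<Rightarrow> 'k rel \<Rightarrow> 'k simplex set"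
  where "nerve n K r =
    {restrict (\<lambda>A. v (Max A)) (cells n) | v.
       v \<in> {0..n} \<rightarrow> K \<and> (\<forall>i j. i \<le> j \<and> j \<le> n \<longrightarrow> (v i, v j) \<in> r)}"

text \<open>\<^term>\<open>nerve_edge a u\<close> is the nerve 1-simplex (a, u) with u \<le> a, i.e. (a; a, u).\<close>

definition nerve_edge :: "'k \<Rightarrow> 'k \<Rightarrow> 'k simplex"
  where "nerve_edge a u = edge a a u"

text \<open>
  A path \<open>b\<^sub>n * \<dots> * b\<^sub>1\<close> is encoded as the list \<open>[b\<^sub>1, \<dots>, b\<^sub>n]\<close> (n > 0).
\<close>

definition is_path :: "'k set \<Rightarrow> 'k rel \<Rightarrow> 'k \<Rightarrow> 'k simplex list \<Rightarrow> 'k \<Rightarrow> bool"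
  where "is_path K r a bs a' \<longleftrightarrow>
    bs \<noteq> [] \<and> set bs \<subseteq> simplices 1 K r \<and> bd1 (hd bs) = a \<and> bd0 (last bs) = a' \<and>
    (\<forall>i. Suc i < length bs \<longrightarrow> bd0 (bs ! i) = bd1 (bs ! Suc i))"

definition pathwise_connected :: "'k set \<Rightarrow> 'k rel \<Rightarrow> bool"
  where "pathwise_connected K r \<longleftrightarrow> (\<forall>a\<in>K. \<forall>a'\<in>K. \<exists>bs. is_path K r a bs a')"

definition fibre :: "'b set \<Rightarrow> ('b \<Rightarrow> 'k) \<Rightarrow> 'k \<Rightarrow> 'b set"
  where "fibre B \<pi> a = {x \<in> B. \<pi> x = a}"

text \<open>
  Maps between fibres are total HOL functions whose values outside the domain fibre are
  irrelevant: all equations between such maps are required on the domain fibre only.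
\<close>

definition net_bundle ::
    "'k set \<Rightarrow> 'k rel \<Rightarrow> 'b set \<Rightarrow> ('b \<Rightarrow> 'k) \<Rightarrow> ('k simplex \<Rightarrow> 'b \<Rightarrow> 'b) \<Rightarrow> bool"
  where "net_bundle K r B \<pi> J \<longleftrightarrow>
    \<pi> ` B = K \<and>
    (\<forall>b\<in>nerve 1 K r. bij_betw (J b) (fibre B \<pi> (bd1 b)) (fibre B \<pi> (bd0 b))) \<and>
    (\<forall>c\<in>nerve 2 K r. \<forall>x\<in>fibre B \<pi> (bd1 (face 2 2 c)).
        J (face 2 0 c) (J (face 2 2 c) x) = J (face 2 1 c) x) \<and>
    (\<forall>a\<in>K. \<forall>x\<in>fibre B \<pi> a. J (degen0 a) x = x)"

definition connection ::
    "'k set \<Rightarrow> 'k rel \<Rightarrow> 'b set \<Rightarrow> ('b \<Rightarrow> 'k) \<Rightarrow> ('k simplex \<Rightarrow> 'b \<Rightarrow> 'b) \<Rightarrow>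
     ('k simplex \<Rightarrow> 'b \<Rightarrow> 'b) \<Rightarrow> bool"
  where "connection K r B \<pi> J U \<longleftrightarrow>
    (\<forall>b\<in>simplices 1 K r. bij_betw (U b) (fibre B \<pi> (bd1 b)) (fibre B \<pi> (bd0 b))) \<and>
    (\<forall>b\<in>simplices 1 K r. \<forall>x\<in>fibre B \<pi> (bd0 b).
        U (reverse b) x = inv_into (fibre B \<pi> (bd1 b)) (U b) x) \<and>
    (\<forall>b\<in>nerve 1 K r. \<forall>x\<in>fibre B \<pi> (bd1 b). U b x = J b x)"

definition flat ::
    "'k set \<Rightarrow> 'k rel \<Rightarrow> 'b set \<Rightarrow> ('b \<Rightarrow> 'k) \<Rightarrow> ('k simplex \<Rightarrow> 'b \<Rightarrow> 'b) \<Rightarrow> bool"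
  where "flat K r B \<pi> U \<longleftrightarrow>
    (\<forall>c\<in>simplices 2 K r. \<forall>x\<in>fibre B \<pi> (bd1 (face 2 2 c)).
        U (face 2 0 c) (U (face 2 2 c) x) = U (face 2 1 c) x)"

definition Z_conn ::
    "'b set \<Rightarrow> ('b \<Rightarrow> 'k) \<Rightarrow> ('k simplex \<Rightarrow> 'b \<Rightarrow> 'b) \<Rightarrow> 'k simplex \<Rightarrow> 'b \<Rightarrow> 'b"
  where "Z_conn B \<pi> J b =
    inv_into (fibre B \<pi> (bd0 b)) (J (nerve_edge (supp 1 b) (bd0 b)))
      \<circ> J (nerve_edge (supp 1 b) (bd1 b))"

text \<open>
  The 1-simplices are exactly the triples (a; u, v) with u, v \<le> a, the nerve 1-simplices are
  exactly the pairs (a, u) with u \<le> a, and faces of 2-simplices are the expected triples and pairs.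
\<close>

lemma cells_1: "cells 1 = {{0}, {1}, {0, 1}}"
proof -
  have e: "{0..1} = {0, 1::nat}" by auto
  have "A \<in> cells 1 \<longleftrightarrow> A = {0} \<or> A = {1} \<or> A = {0, 1}" for A
    unfolding cells_def e by blast
  then show ?thesis by blast
qed

lemma vertex_set_neq: "{0::nat} \<noteq> {1}" "{0::nat} \<noteq> {0, 1}" "{1::nat} \<noteq> {0, 1}"
    "{1::nat} \<noteq> {0}" "{0::nat, 1} \<noteq> {0}" "{0::nat, 1} \<noteq> {1}"
  by (simp_all add: set_eq_iff) presburger+

lemma in_cells_1: "{0} \<in> cells 1" "{1} \<in> cells 1" "{0, 1} \<in> cells 1"
  by (simp_all only: cells_1 insert_iff) simp_all

lemma bd_simps: "bd0 b = b {1}" "bd1 b = b {0}"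
  by (simp_all add: bd0_def bd1_def face_def cells_def coface_def)

lemma supp_1: "supp 1 b = b {0, 1}"
proof -
  have "{0..1} = {0, 1::nat}" by auto
  then show ?thesis by (simp only: supp_def)
qed

lemma edge_simps: "supp 1 (edge a u v) = a" "bd0 (edge a u v) = u" "bd1 (edge a u v) = v"
  by (simp_all only: supp_1 bd_simps edge_def in_cells_1
      restrict_apply' vertex_set_neq if_True if_False simp_thms)

lemma edge_apply: "edge a u v {0, 1} = a" "edge a u v {1} = u" "edge a u v {0} = v"
  by (simp_all only: edge_def in_cells_1 restrict_apply' vertex_set_neq if_True if_False simp_thms)

lemma edge_eta:
  assumes "b \<in> extensional (cells 1)"
  shows "edge (b {0, 1}) (b {1}) (b {0}) = b"
proof
  fix A
  consider "A = {0, 1}" | "A = {1}" | "A = {0}" | "A \<notin> cells 1"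
    unfolding cells_1 by blast
  then show "edge (b {0, 1}) (b {1}) (b {0}) A = b A"
  proof cases
    case 4
    then show ?thesis
      by (simp only: edge_def restrict_def if_False extensional_arb[OF assms 4])
  qed (simp_all only: edge_apply)
qed

lemma simplices_1:
  assumes "partial_order_on K r"
  shows "simplices 1 K r = {edge a u v | a u v. (u, a) \<in> r \<and> (v, a) \<in> r}"
proof (intro set_eqI iffI)
  fix b assume b: "b \<in> simplices 1 K r"
  then have m: "monotone_on (cells 1) (\<subseteq>) (\<lambda>x y. (x, y) \<in> r) b"
    and e: "b \<in> extensional (cells 1)"
    unfolding simplices_def PiE_def by blast+
  have "(b {1}, b {0, 1}) \<in> r" "(b {0}, b {0, 1}) \<in> r"
    by (rule monotone_onD[OF m in_cells_1(2,3)], blast)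
       (rule monotone_onD[OF m in_cells_1(1,3)], blast)
  then show "b \<in> {edge a u v | a u v. (u, a) \<in> r \<and> (v, a) \<in> r}"
    unfolding mem_Collect_eq using edge_eta[OF e, symmetric] by (intro exI conjI)
next
  fix b assume "b \<in> {edge a u v | a u v. (u, a) \<in> r \<and> (v, a) \<in> r}"
  then obtain a u v where b: "b = edge a u v" "(u, a) \<in> r" "(v, a) \<in> r" by blast
  note po = partial_order_onD[OF assms]
  have K: "a \<in> K" "u \<in> K" "v \<in> K" using b po(4) by blast+
  then have refl: "(a, a) \<in> r" "(u, u) \<in> r" "(v, v) \<in> r"
    using po(1) by (simp_all only: refl_on_def)
  have "b \<in> extensional (cells 1)" unfolding b edge_def by (rule restrict_extensional)
  moreover have bK: "b A \<in> K" if "A \<in> cells 1" for A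
    using that K unfolding cells_1 b(1) by (elim insertE emptyE) (simp_all only: edge_apply)
  moreover have "(b A, b A') \<in> r" if "A \<in> cells 1" "A' \<in> cells 1" "A \<subseteq> A'" for A A'
  proof -
    have "A = A' \<or> A' = {0, 1}"
      using that unfolding cells_1 by auto
    then show ?thesis
    proof
      assume "A = A'"
      with po(1) bK[OF that(1)] show ?thesis by (simp add: refl_on_def)
    next
      assume A': "A' = {0, 1}"
      show ?thesis
        using that(1) b(2,3) refl unfolding cells_1 b(1) A'
        by (elim insertE emptyE) (simp_all only: edge_apply)
    qed
  qed
  ultimately show "b \<in> simplices 1 K r"
    unfolding simplices_def by (intro CollectI conjI PiE_I monotone_onI) (assumption | erule (1) extensional_arb)+
qed

lemma nerve_1:
  fixes K :: "'k set"
  assumes "partial_order_on K r"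
  shows "nerve 1 K r = {nerve_edge a u | a u. (u, a) \<in> r}"
proof -
  have *: "restrict (\<lambda>A. v (Max A)) (cells 1) = nerve_edge (v 1) (v 0)" for v :: "nat \<Rightarrow> 'k"
  proof -
    have m: "Max {0, 1::nat} = 1" "Max {0::nat} = 0" "Max {1::nat} = 1" by simp_all
    show ?thesis
      using edge_eta[of "restrict (\<lambda>A. v (Max A)) (cells 1)"]
      by (simp only: nerve_edge_def restrict_extensional restrict_apply' in_cells_1 m simp_thms)
  qed
  show ?thesis
  proof (intro set_eqI iffI)
    fix b assume "b \<in> nerve 1 K r"
    then have "\<exists>v :: nat \<Rightarrow> 'k. b = nerve_edge (v 1) (v 0) \<and> (\<forall>i j. i \<le> j \<and> j \<le> 1 \<longrightarrow> (v i, v j) \<in> r)"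
      unfolding nerve_def * mem_Collect_eq by (elim exE conjE) (intro exI conjI)
    then obtain v :: "nat \<Rightarrow> 'k" where "b = nerve_edge (v 1) (v 0)"
      and v: "\<forall>i j. i \<le> j \<and> j \<le> 1 \<longrightarrow> (v i, v j) \<in> r" by (elim exE conjE)
    moreover from v have "(v 0, v 1) \<in> r" by simp
    ultimately show "b \<in> {nerve_edge a u | a u. (u, a) \<in> r}" by blast
  next
    fix b assume "b \<in> {nerve_edge a u | a u. (u, a) \<in> r}"
    then obtain a u where b: "b = nerve_edge a u" "(u, a) \<in> r" by blast
    define v where "v i = (if i = 0 then u else a)" for i :: nat
    note po = partial_order_onD[OF assms]
    have K: "a \<in> K" "u \<in> K" using b po(4) by blast+
    then have "(a, a) \<in> r" "(u, u) \<in> r" using po(1) by (simp_all only: refl_on_def)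
    then have "\<forall>i j. i \<le> j \<and> j \<le> 1 \<longrightarrow> (v i, v j) \<in> r"
      using b(2) by (simp add: v_def)
    moreover have "v \<in> {0..1} \<rightarrow> K"
      using K by (simp add: v_def)
    moreover have "b = restrict (\<lambda>A. v (Max A)) (cells 1)"
      unfolding * by (simp add: v_def b(1))
    ultimately show "b \<in> nerve 1 K r"
      unfolding nerve_def mem_Collect_eq by (intro exI[of _ v] conjI)
  qed
qed

lemma face_2:
  "face 2 0 c = edge (c {1, 2}) (c {2}) (c {1})"
  "face 2 1 c = edge (c {0, 2}) (c {2}) (c {0})"
  "face 2 2 c = edge (c {0, 1}) (c {1}) (c {0})"
proof -
  have "face 2 i c = edge (c (coface i ` {0, 1})) (c (coface i ` {1})) (c (coface i ` {0}))" for i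
    using edge_eta[of "face 2 i c"]
    by (simp only: face_def diff_Suc_1 numeral_2_eq_2 One_nat_def[symmetric]
        restrict_extensional restrict_apply' in_cells_1 simp_thms)
  then show
    "face 2 0 c = edge (c {1, 2}) (c {2}) (c {1})"
    "face 2 1 c = edge (c {0, 2}) (c {2}) (c {0})"
    "face 2 2 c = edge (c {0, 1}) (c {1}) (c {0})"
    by (simp_all add: coface_def numeral_2_eq_2 insert_commute)
qed

lemma nerve_2_faces:
  fixes v :: "nat \<Rightarrow> 'k"
  defines "c \<equiv> restrict (\<lambda>A. v (Max A)) (cells 2)"
  shows "face 2 0 c = nerve_edge (v 2) (v 1)" "face 2 1 c = nerve_edge (v 2) (v 0)"
    "face 2 2 c = nerve_edge (v 1) (v 0)" "supp 2 c = v 2"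
proof -
  have "Max {0..2::nat} = 2" by (rule Max_eqI) auto
  then show "face 2 0 c = nerve_edge (v 2) (v 1)" "face 2 1 c = nerve_edge (v 2) (v 0)"
    "face 2 2 c = nerve_edge (v 1) (v 0)" "supp 2 c = v 2"
    unfolding face_2 nerve_edge_def supp_def c_def cells_def
    by (simp_all add: numeral_2_eq_2)
qed

end

(* Write j a u for the net structure along u \<le> a. For x over v and y over u, both below a, Z sends x
   to y along (a; u, v) iff j a u y = j a v x, and a may be replaced by any larger element because the
   net structure is functorial. Flatness is then read off at the support of a 2-simplex.
   Conversely, the 2-simplex with vertices v, u, a and all edges supported by a has the two outer
   faces (a, u) and (a, v) in the nerve, so flatness forces j a u (U b x) = j a v x for
   b = (a; u, v). *)

theory Submission
  imports Defs
begin

lemma cells_2: "cells 2 = {{0}, {1}, {2}, {0, 1}, {0, 2}, {1, 2}, {0, 1, 2}}"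
proof -
  have e: "{0..2} = {0, 1, 2::nat}" by auto
  have "A \<in> cells 2 \<longleftrightarrow> A = {0} \<or> A = {1} \<or> A = {2} \<or> A = {0, 1} \<or> A = {0, 2} \<or>
      A = {1, 2} \<or> A = {0, 1, 2}" for A
    unfolding cells_def e by blast
  then show ?thesis by blast
qed

lemma simplices_monoD:
  assumes "c \<in> simplices n K r" "A \<in> cells n" "A' \<in> cells n" "A \<subseteq> A'"
  shows "(c A, c A') \<in> r"
  using assms unfolding simplices_def by (auto dest: monotone_onD)

lemma reverse_edge: "reverse (edge a u v) = edge a v u"
  by (simp only: reverse_def edge_simps)

text \<open>Lets an arbitrary 1-simplex (a; u, v) occur as a face of a 2-simplex whose other two
  faces lie in the nerve, where any connection must agree with \<open>J\<close>.\<close>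

lemma ex_simplex_cone:
  assumes po: "partial_order_on K r" and le: "(u, a) \<in> r" "(v, a) \<in> r"
  obtains c where "c \<in> simplices 2 K r" "face 2 0 c = nerve_edge a u"
    "face 2 1 c = nerve_edge a v" "face 2 2 c = edge a u v"
proof
  \<comment> \<open>The third vertex {2} and every cell of positive dimension go to a, so the faces
    0 and 1 are pairs (a, u) and (a, v).\<close>
  define f where "f A = (if A = {0} then v else if A = {1} then u else a)" for A :: "nat set"
  define c where "c = restrict f (cells 2)"
  have K: "a \<in> K" "u \<in> K" "v \<in> K" using le partial_order_onD(4)[OF po] by blast+
  then have refl: "(a, a) \<in> r" "(u, u) \<in> r" "(v, v) \<in> r"
    using partial_order_onD(1)[OF po] by (simp_all only: refl_on_def)
  have "(f A, f A') \<in> r" if "A \<in> cells 2" "A' \<in> cells 2" "A \<subseteq> A'" for A A'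
  proof -
    \<comment> \<open>A non-empty cell inside a singleton equals it, so the cases {0} and {1} for A'
      reduce to reflexivity. Any other A' has value a, which bounds u, v and a.\<close>
    have "A = {i}" if "A' = {i}" for i
      using that \<open>A \<subseteq> A'\<close> \<open>A \<in> cells 2\<close> unfolding cells_def by blast
    then show ?thesis
      unfolding f_def using le refl by (simp split: if_split)
  qed
  then show "c \<in> simplices 2 K r"
    using K by (auto simp: simplices_def c_def f_def intro!: monotone_onI)
  have c: "c {1, 2} = a" "c {0, 2} = a" "c {0, 1} = a" "c {2} = a" "c {1} = u" "c {0} = v"
    unfolding c_def by (simp_all add: cells_2 f_def)
  show "face 2 0 c = nerve_edge a u" "face 2 1 c = nerve_edge a v" "face 2 2 c = edge a u v"
    by (simp_all only: face_2 nerve_edge_def c)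
qed

context
  fixes K :: "'k set" and r :: "'k rel" and B :: "'b set" and \<pi> :: "'b \<Rightarrow> 'k"
    and J :: "'k simplex \<Rightarrow> 'b \<Rightarrow> 'b"
  assumes po: "partial_order_on K r" and nb: "net_bundle K r B \<pi> J"
begin

lemma net_bij:
  assumes "(u, a) \<in> r"
  shows "bij_betw (J (nerve_edge a u)) (fibre B \<pi> u) (fibre B \<pi> a)"
proof -
  have "nerve_edge a u \<in> nerve 1 K r" using assms unfolding nerve_1[OF po] by blast
  then have "bij_betw (J (nerve_edge a u))
      (fibre B \<pi> (bd1 (nerve_edge a u))) (fibre B \<pi> (bd0 (nerve_edge a u)))"
    using nb unfolding net_bundle_def by blast
  then show ?thesis by (simp only: nerve_edge_def edge_simps)
qed

lemma net_in: "(u, a) \<in> r \<Longrightarrow> x \<in> fibre B \<pi> u \<Longrightarrow> J (nerve_edge a u) x \<in> fibre B \<pi> a"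
  using net_bij by (blast dest: bij_betwE)

lemma net_eq_iff:
  assumes "(u, a) \<in> r" "x \<in> fibre B \<pi> u" "y \<in> fibre B \<pi> u"
  shows "J (nerve_edge a u) x = J (nerve_edge a u) y \<longleftrightarrow> x = y"
  using bij_betw_imp_inj_on[OF net_bij[OF assms(1)]] assms(2,3) by (rule inj_on_eq_iff)

lemma net_comp:
  assumes le: "(u, a) \<in> r" "(a, w) \<in> r" and x: "x \<in> fibre B \<pi> u"
  shows "J (nerve_edge w a) (J (nerve_edge a u) x) = J (nerve_edge w u) x"
proof -
  \<comment> \<open>The chain u \<le> a \<le> w: its faces 2, 0 and 1 are (a, u), (w, a) and (w, u),
    so the cocycle identity of the net structure at this simplex is the claim.\<close>
  define v where "v i = (if i = 0 then u else if i = 1 then a else w)" for i :: nat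
  define c where "c = restrict (\<lambda>A. v (Max A)) (cells 2)"
  note poD = partial_order_onD[OF po]
  have K: "u \<in> K" "a \<in> K" "w \<in> K" using le poD(4) by blast+
  then have refl: "(u, u) \<in> r" "(a, a) \<in> r" "(w, w) \<in> r"
    using poD(1) by (simp_all only: refl_on_def)
  have "(u, w) \<in> r" using le poD(2) by (blast dest: transD)
  then have "\<forall>i j. i \<le> j \<and> j \<le> 2 \<longrightarrow> (v i, v j) \<in> r"
    using le refl by (auto simp: v_def)
  moreover have "v \<in> {0..2} \<rightarrow> K" using K by (simp add: v_def)
  ultimately have "c \<in> nerve 2 K r"
    unfolding nerve_def c_def by blast
  moreover have "v 0 = u" "v 1 = a" "v 2 = w" by (simp_all add: v_def)
  then have f: "face 2 0 c = nerve_edge w a" "face 2 1 c = nerve_edge w u"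
      "face 2 2 c = nerve_edge a u"
    unfolding c_def nerve_2_faces by simp_all
  moreover have "bd1 (face 2 2 c) = u" by (simp only: f nerve_edge_def edge_simps)
  ultimately show ?thesis using nb x unfolding net_bundle_def by metis
qed

lemma net_refl: "a \<in> K \<Longrightarrow> x \<in> fibre B \<pi> a \<Longrightarrow> J (nerve_edge a a) x = x"
  using nb unfolding net_bundle_def degen0_def nerve_edge_def by blast

lemma Z_edge:
  "Z_conn B \<pi> J (edge a u v) =
    inv_into (fibre B \<pi> u) (J (nerve_edge a u)) \<circ> J (nerve_edge a v)"
  by (simp only: Z_conn_def edge_simps)

lemma Z_bij:
  assumes "(u, a) \<in> r" "(v, a) \<in> r"
  shows "bij_betw (Z_conn B \<pi> J (edge a u v)) (fibre B \<pi> v) (fibre B \<pi> u)"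
  unfolding Z_edge using assms by (blast intro: bij_betw_trans net_bij bij_betw_inv_into)

lemma Z_in:
  "(u, a) \<in> r \<Longrightarrow> (v, a) \<in> r \<Longrightarrow> x \<in> fibre B \<pi> v \<Longrightarrow>
    Z_conn B \<pi> J (edge a u v) x \<in> fibre B \<pi> u"
  using Z_bij by (blast dest: bij_betwE)

text \<open>Over a itself this is the definition of Z, since \<open>inv_into\<close> is a right
  inverse of the bijection J along u \<le> a; applying J along a \<le> w carries it to w. The free
  bound w is what allows faces with different supports to be compared in one fibre.\<close>

lemma net_Z:
  assumes "(u, a) \<in> r" "(v, a) \<in> r" "(a, w) \<in> r" "x \<in> fibre B \<pi> v"
  shows "J (nerve_edge w u) (Z_conn B \<pi> J (edge a u v) x) = J (nerve_edge w v) x"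
proof -
  have "J (nerve_edge a u) (Z_conn B \<pi> J (edge a u v) x) = J (nerve_edge a v) x"
    unfolding Z_edge comp_apply
    using assms(1,2,4) by (blast intro: bij_betw_inv_into_right net_bij net_in)
  then show ?thesis
    using net_comp[OF assms(1,3) Z_in[OF assms(1,2,4)]] net_comp[OF assms(2-4)] by simp
qed

text \<open>J along u \<le> w is injective, so \<open>net_Z\<close> determines the value of Z. This
  criterion replaces \<open>inv_into\<close> in the arguments below.\<close>

lemma eq_Z_iff:
  assumes "(u, a) \<in> r" "(v, a) \<in> r" "(a, w) \<in> r" "x \<in> fibre B \<pi> v" "y \<in> fibre B \<pi> u"
  shows "y = Z_conn B \<pi> J (edge a u v) x \<longleftrightarrow> J (nerve_edge w u) y = J (nerve_edge w v) x"
proof -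
  have "(u, w) \<in> r" using assms(1,3) partial_order_onD(2)[OF po] by (blast dest: transD)
  from net_eq_iff[OF this assms(5) Z_in[OF assms(1,2,4)]] show ?thesis
    by (simp only: net_Z[OF assms(1-4)])
qed

lemma order_refl: "(u, a) \<in> r \<Longrightarrow> (a, a) \<in> r"
  using partial_order_onD(1,4)[OF po] by (auto simp: refl_on_def)

lemma Z_reverse:
  assumes "(u, a) \<in> r" "(v, a) \<in> r" "x \<in> fibre B \<pi> u"
  shows "Z_conn B \<pi> J (edge a v u) x =
    inv_into (fibre B \<pi> v) (Z_conn B \<pi> J (edge a u v)) x"
proof -
  let ?y = "Z_conn B \<pi> J (edge a v u) x"
  have y: "?y \<in> fibre B \<pi> v" by (rule Z_in[OF assms(2,1,3)])
  have a: "(a, a) \<in> r" using assms(1) by (rule order_refl)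
  \<comment> \<open>With w = a the criterion is symmetric in the two ends of the edge: what it asks
    here is \<open>net_Z\<close> for the reversed edge.\<close>
  have "x = Z_conn B \<pi> J (edge a u v) ?y"
    unfolding eq_Z_iff[OF assms(1,2) a y assms(3)] by (rule net_Z[OF assms(2,1) a assms(3), symmetric])
  then show ?thesis
    using inv_into_f_eq[OF bij_betw_imp_inj_on[OF Z_bij[OF assms(1,2)]] y] by simp
qed

text \<open>For (a; a, u) the criterion at w = a compares J along a \<le> a with J along u \<le> a,
  and the former is the identity.\<close>

lemma Z_nerve:
  assumes "(u, a) \<in> r" "x \<in> fibre B \<pi> u"
  shows "Z_conn B \<pi> J (nerve_edge a u) x = J (nerve_edge a u) x"
proof -
  have a: "(a, a) \<in> r" using assms(1) by (rule order_refl)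
  then have "a \<in> K" using partial_order_onD(4)[OF po] by blast
  then have "J (nerve_edge a a) (J (nerve_edge a u) x) = J (nerve_edge a u) x"
    using net_in[OF assms] by (rule net_refl)
  then have "J (nerve_edge a u) x = Z_conn B \<pi> J (edge a a u) x"
    unfolding eq_Z_iff[OF a assms(1) a assms(2) net_in[OF assms]] .
  then show ?thesis by (simp add: nerve_edge_def)
qed

lemma connection_Z: "connection K r B \<pi> J (Z_conn B \<pi> J)"
  unfolding connection_def simplices_1[OF po] nerve_1[OF po]
proof (intro conjI ballI)
  fix b assume "b \<in> {edge a u v | a u v. (u, a) \<in> r \<and> (v, a) \<in> r}"
  then obtain a u v where b: "b = edge a u v" and le: "(u, a) \<in> r" "(v, a) \<in> r" by blast
  show "bij_betw (Z_conn B \<pi> J b) (fibre B \<pi> (bd1 b)) (fibre B \<pi> (bd0 b))"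
    unfolding b edge_simps by (rule Z_bij[OF le])
  show "Z_conn B \<pi> J (reverse b) x = inv_into (fibre B \<pi> (bd1 b)) (Z_conn B \<pi> J b) x"
    if "x \<in> fibre B \<pi> (bd0 b)" for x
    using that unfolding b reverse_edge edge_simps by (rule Z_reverse[OF le])
next
  fix b x assume "b \<in> {nerve_edge a u | a u. (u, a) \<in> r}" and x: "x \<in> fibre B \<pi> (bd1 b)"
  then obtain a u where b: "b = nerve_edge a u" and le: "(u, a) \<in> r" by blast
  from x have "x \<in> fibre B \<pi> u" by (simp only: b nerve_edge_def edge_simps)
  then show "Z_conn B \<pi> J b x = J b x" unfolding b by (rule Z_nerve[OF le])
qed

lemma flat_Z: "flat K r B \<pi> (Z_conn B \<pi> J)"
  unfolding flat_def
proof (intro ballI)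
  fix c x assume c: "c \<in> simplices 2 K r" and "x \<in> fibre B \<pi> (bd1 (face 2 2 c))"
  then have x: "x \<in> fibre B \<pi> (c {0})" by (simp only: face_2 edge_simps)
  let ?Z = "Z_conn B \<pi> J" and ?w = "c {0, 1, 2}"
  \<comment> \<open>One row for each of the faces 2, 0 and 1: target below support, source below
    support, support below the common bound \<open>?w\<close>.\<close>
  have le: "(c {1}, c {0, 1}) \<in> r" "(c {0}, c {0, 1}) \<in> r" "(c {0, 1}, ?w) \<in> r"
      "(c {2}, c {1, 2}) \<in> r" "(c {1}, c {1, 2}) \<in> r" "(c {1, 2}, ?w) \<in> r"
      "(c {2}, c {0, 2}) \<in> r" "(c {0}, c {0, 2}) \<in> r" "(c {0, 2}, ?w) \<in> r"
    by (rule simplices_monoD[OF c]; simp add: cells_2)+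
  let ?y = "?Z (edge (c {0, 1}) (c {1}) (c {0})) x"
  let ?z = "?Z (edge (c {1, 2}) (c {2}) (c {1})) ?y"
  have y: "?y \<in> fibre B \<pi> (c {1})" by (rule Z_in[OF le(1,2) x])
  have z: "?z \<in> fibre B \<pi> (c {2})" by (rule Z_in[OF le(4,5) y])
  \<comment> \<open>Transported to the fibre over \<open>?w\<close>, the points \<open>?z\<close>,
    \<open>?y\<close> and x coincide; the criterion for face 1 needs just this for \<open>?z\<close>
    and x.\<close>
  have "J (nerve_edge ?w (c {2})) ?z = J (nerve_edge ?w (c {1})) ?y"
    by (rule net_Z[OF le(4-6) y])
  also have "\<dots> = J (nerve_edge ?w (c {0})) x"
    by (rule net_Z[OF le(1-3) x])
  finally show "?Z (face 2 0 c) (?Z (face 2 2 c) x) = ?Z (face 2 1 c) x"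
    unfolding face_2 eq_Z_iff[OF le(7-9) x z] .
qed

lemma flat_connection_eq_Z:
  assumes U: "connection K r B \<pi> J U" "flat K r B \<pi> U"
    and b: "b \<in> simplices 1 K r" and x: "x \<in> fibre B \<pi> (bd1 b)"
  shows "U b x = Z_conn B \<pi> J b x"
proof -
  obtain a u v where e: "b = edge a u v" and le: "(u, a) \<in> r" "(v, a) \<in> r"
    using b unfolding simplices_1[OF po] by blast
  obtain c where c: "c \<in> simplices 2 K r" "face 2 0 c = nerve_edge a u"
    "face 2 1 c = nerve_edge a v" "face 2 2 c = edge a u v"
    using ex_simplex_cone[OF po le] .
  have xv: "x \<in> fibre B \<pi> v" using x by (simp only: e edge_simps)
  have "bij_betw (U b) (fibre B \<pi> (bd1 b)) (fibre B \<pi> (bd0 b))"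
    using U(1) b unfolding connection_def by blast
  \<comment> \<open>Both the agreement of U with J and the criterion for Z speak only of points in
    the appropriate fibre, so U b x must first be placed over u.\<close>
  then have Ux: "U b x \<in> fibre B \<pi> u"
    using x by (simp only: e edge_simps bij_betw_apply)
  have UJ: "U (nerve_edge a w) y = J (nerve_edge a w) y" if "(w, a) \<in> r" "y \<in> fibre B \<pi> w" for w y
  proof -
    have "nerve_edge a w \<in> nerve 1 K r" using that(1) unfolding nerve_1[OF po] by blast
    moreover have "y \<in> fibre B \<pi> (bd1 (nerve_edge a w))"
      using that(2) by (simp only: nerve_edge_def edge_simps)
    ultimately show ?thesis using U(1) unfolding connection_def by blast
  qed
  \<comment> \<open>Flatness at the cone: following b and then (a, u) is the same as following (a,
    v).\<close>
  have "U (nerve_edge a u) (U b x) = U (nerve_edge a v) x"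
    using U(2) c x unfolding flat_def e by metis
  then have "J (nerve_edge a u) (U b x) = J (nerve_edge a v) x"
    by (simp only: UJ[OF le(1) Ux] UJ[OF le(2) xv])
  then show ?thesis
    using eq_Z_iff[OF le order_refl[OF le(1)] xv Ux] unfolding e by blast
qed

end

text \<open>Uniqueness means equality on 1-simplices and on the fibre over the 1-face, because the
  values of these total functions elsewhere carry no meaning.\<close>

theorem proposition4p4:
  fixes K :: "'k set" and r :: "'k rel" and B :: "'b set" and \<pi> :: "'b \<Rightarrow> 'k"
    and J :: "'k simplex \<Rightarrow> 'b \<Rightarrow> 'b"
  assumes "partial_order_on K r"
    and "pathwise_connected K r"
    and "net_bundle K r B \<pi> J"
  shows "connection K r B \<pi> J (Z_conn B \<pi> J) \<and> flat K r B \<pi> (Z_conn B \<pi> J) \<and>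
    (\<forall>U. connection K r B \<pi> J U \<and> flat K r B \<pi> U \<longrightarrow>
       (\<forall>b\<in>simplices 1 K r. \<forall>x\<in>fibre B \<pi> (bd1 b). U b x = Z_conn B \<pi> J b x))"
  using connection_Z[OF assms(1,3)] flat_Z[OF assms(1,3)] flat_connection_eq_Z[OF assms(1,3)]
  by blast

end
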